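(* Let $p$ be a prime and let $G$ be a nonabelian ab-maximal finite $p$-group. Then $|G:G'| \ge |Z(G)|\, p^3$.
   Context: $G'=[G,G]$ denotes the derived subgroup and $Z(G)$ the center of $G$. A finite group $G$ is called ab-maximal if $|H:H'| < |G:G'|$ for every proper subgroup $H$ of $G$. *)

theory Defs
  imports "HOL-Algebra.Algebra"
begin

definition center :: "('a, 'b) monoid_scheme \<Rightarrow> 'a set" where
  "center G = {z \<in> carrier G. \<forall>g \<in> carrier G. z \<otimes>\<^bsub>G\<^esub> g = g \<otimes>\<^bsub>G\<^esub> z}"

text \<open>The number of cosets \<open>|G : G'|\<close>; for a subgroup \<open>H\<close> of \<open>G\<close>, the index \<open>|H : H'|\<close>
  is \<open>ab_index (G\<lparr>carrier := H\<rparr>)\<close>.\<close>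

definition ab_index :: "('a, 'b) monoid_scheme \<Rightarrow> nat" where
  "ab_index G = card (rcosets\<^bsub>G\<^esub> (derived G (carrier G)))"

definition ab_maximal :: "('a, 'b) monoid_scheme \<Rightarrow> bool" where
  "ab_maximal G \<longleftrightarrow> group G \<and> finite (carrier G) \<and>
     (\<forall>H. subgroup H G \<and> H \<noteq> carrier G \<longrightarrow> ab_index (G\<lparr>carrier := H\<rparr>) < ab_index G)"

definition finite_p_group :: "nat \<Rightarrow> ('a, 'b) monoid_scheme \<Rightarrow> bool" where
  "finite_p_group p G \<longleftrightarrow> group G \<and> finite (carrier G) \<and> (\<exists>n. order G = p ^ n)"

end

theory Submission
  imports Defs
begin

text \<open>The conjugacy class of any \<open>x\<close> lies in \<open>G' x\<close>, so \<open>|G : C(x)| \<le> |G'|\<close>, that is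
  \<open>|C(x)| \<ge> |G : G'|\<close>. If \<open>x\<close> is not central, then ab-maximality forbids \<open>C(x)\<close> to be abelian,
  so \<open>C(x)\<close> contains some \<open>y\<close> outside the abelian group \<open>\<langle>Z(G), x\<rangle>\<close>. Then \<open>\<langle>Z(G), x, y\<rangle>\<close> is abelian
  of order at least \<open>|Z(G)| p\<^sup>2\<close>, and ab-maximality makes \<open>|G : G'|\<close> a strictly larger power
  of \<open>p\<close>.\<close>

text \<open>Taking a set \<open>S\<close> lets one subgroup lemma serve three cases: the center
  (\<open>S = carrier G\<close>), the centralizer of one element, and the centralizer of a generated
  subgroup.\<close>

definition centralizer :: "('a, 'b) monoid_scheme \<Rightarrow> 'a set \<Rightarrow> 'a set" where
  "centralizer G S = {g \<in> carrier G. \<forall>s \<in> S. g \<otimes>\<^bsub>G\<^esub> s = s \<otimes>\<^bsub>G\<^esub> g}"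

lemma center_eq_centralizer: "center G = centralizer G (carrier G)"
  by (simp add: center_def centralizer_def)

context group
begin

lemma subgroup_centralizer:
  assumes "S \<subseteq> carrier G"
  shows "subgroup (centralizer G S) G"
proof (rule subgroupI)
  show "centralizer G S \<subseteq> carrier G"
    by (auto simp: centralizer_def)
  have "\<one> \<in> centralizer G S"
    using assms by (auto simp: centralizer_def)
  then show "centralizer G S \<noteq> {}"
    by blast
next
  fix g assume g: "g \<in> centralizer G S"
  have "inv g \<otimes> s = s \<otimes> inv g" if "s \<in> S" for s
  proof -
    have s: "s \<in> carrier G" "g \<in> carrier G" "g \<otimes> s = s \<otimes> g"
      using g that assms by (auto simp: centralizer_def)
    then have "s = inv g \<otimes> (s \<otimes> g)"
      by (simp add: inv_solve_left)
    then show ?thesis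
      using s by (simp add: inv_solve_right m_assoc)
  qed
  then show "inv g \<in> centralizer G S"
    using g by (auto simp: centralizer_def)
next
  fix g h assume g: "g \<in> centralizer G S" and h: "h \<in> centralizer G S"
  have "g \<otimes> h \<otimes> s = s \<otimes> (g \<otimes> h)" if "s \<in> S" for s
  proof -
    have "s \<in> carrier G" "g \<in> carrier G" "h \<in> carrier G" "g \<otimes> s = s \<otimes> g" "h \<otimes> s = s \<otimes> h"
      using g h that assms by (auto simp: centralizer_def)
    then show ?thesis
      by (metis m_assoc)
  qed
  then show "g \<otimes> h \<in> centralizer G S"
    using g h by (auto simp: centralizer_def)
qed

text \<open>Double centralizer argument: \<open>S\<close> lies in the subgroup C(S), hence so does
  \<open>generate G S\<close>. By symmetry \<open>S\<close> lies in the centralizer of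
  \<open>generate G S\<close>, and closing up once more gives the claim.\<close>

lemma generate_commute:
  assumes S: "S \<subseteq> carrier G" and comm: "\<And>s t. \<lbrakk>s \<in> S; t \<in> S\<rbrakk> \<Longrightarrow> s \<otimes> t = t \<otimes> s"
    and a: "a \<in> generate G S" and b: "b \<in> generate G S"
  shows "a \<otimes> b = b \<otimes> a"
proof -
  have gen: "generate G S \<subseteq> carrier G"
    using S by (rule generate_incl)
  have "S \<subseteq> centralizer G S"
    using S comm by (auto simp: centralizer_def)
  then have "generate G S \<subseteq> centralizer G S"
    by (rule generate_subgroup_incl[OF _ subgroup_centralizer[OF S]])
  then have "S \<subseteq> centralizer G (generate G S)"
    using S by (fastforce simp: centralizer_def)
  then have "generate G S \<subseteq> centralizer G (generate G S)"
    by (rule generate_subgroup_incl[OF _ subgroup_centralizer[OF gen]])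
  then show ?thesis
    using a b by (auto simp: centralizer_def)
qed

lemma ab_index_lagrange:
  assumes "finite (carrier G)"
  shows "ab_index G * card (derived G (carrier G)) = order G"
  unfolding ab_index_def
  using lagrange_finite[OF assms derived_is_subgroup[OF subset_refl]] .

text \<open>The derived subgroup of an abelian group is trivial, so Lagrange leaves only the
  order.\<close>

lemma ab_index_abelian_subgroup:
  assumes "finite (carrier G)" and H: "subgroup H G"
    and comm: "\<And>a b. \<lbrakk>a \<in> H; b \<in> H\<rbrakk> \<Longrightarrow> a \<otimes> b = b \<otimes> a"
  shows "ab_index (G\<lparr>carrier := H\<rparr>) = card H"
proof -
  interpret H: comm_group "G\<lparr>carrier := H\<rparr>"
    using subgroup_imp_group[OF H] comm by (intro group.group_comm_groupI) auto
  have "finite H"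
    using assms(1) subgroup.subset[OF H] by (rule rev_finite_subset)
  then show ?thesis
    using H.ab_index_lagrange H.derived_eq_singleton[OF subset_refl] by (simp add: order_def)
qed

text \<open>Orbit-stabilizer for the conjugation action: the stabilizer of \<open>x\<close> is its
  centralizer, and the orbit is no larger than G'.\<close>

lemma order_le_card_derived_mult_card_centralizer:
  assumes fin: "finite (carrier G)" and x: "x \<in> carrier G"
  shows "order G \<le> card (derived G (carrier G)) * card (centralizer G {x})"
proof -
  let ?\<phi> = "\<lambda>g. \<lambda>h\<in>carrier G. g \<otimes> h \<otimes> inv g"
  interpret conj: group_action G "carrier G" ?\<phi>
    by (rule action_by_conjugation)
  have "g \<otimes> x \<otimes> inv g = x \<longleftrightarrow> g \<otimes> x = x \<otimes> g" if "g \<in> carrier G" for g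
    using that x by (metis inv_solve_right' m_closed)
  then have stab: "stabilizer G ?\<phi> x = centralizer G {x}"
    using x by (auto simp: stabilizer_def centralizer_def)
  have "orbit G ?\<phi> x \<subseteq> (\<lambda>d. d \<otimes> x) ` derived G (carrier G)"
  proof
    fix z assume "z \<in> orbit G ?\<phi> x"
    then obtain g where g: "g \<in> carrier G" "z = g \<otimes> x \<otimes> inv g"
      using x by (auto simp: orbit_def)
    \<comment> \<open>A conjugate of \<open>x\<close> is the commutator of \<open>g\<close> and
      \<open>x\<close> times \<open>x\<close>, hence lies in the coset G' x.\<close>
    then have "z = (g \<otimes> x \<otimes> inv g \<otimes> inv x) \<otimes> x"
      using x by (simp add: m_assoc)
    moreover have "g \<otimes> x \<otimes> inv g \<otimes> inv x \<in> derived G (carrier G)"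
      unfolding derived_def using g(1) x by (intro generate.incl) blast
    ultimately show "z \<in> (\<lambda>d. d \<otimes> x) ` derived G (carrier G)"
      by blast
  qed
  moreover have "finite (derived G (carrier G))"
    using fin derived_in_carrier[OF subset_refl] by (rule rev_finite_subset)
  ultimately have "card (orbit G ?\<phi> x) \<le> card (derived G (carrier G))"
    using surj_card_le by blast
  then have "card (orbit G ?\<phi> x) * card (stabilizer G ?\<phi> x)
      \<le> card (derived G (carrier G)) * card (centralizer G {x})"
    unfolding stab by (rule mult_le_mono1)
  then show ?thesis
    unfolding conj.orbit_stabilizer_theorem[OF x] .
qed

lemma ab_index_le_card_centralizer:
  assumes fin: "finite (carrier G)" and x: "x \<in> carrier G"
  shows "ab_index G \<le> card (centralizer G {x})"
proof -
  have "finite (derived G (carrier G))"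
    using fin derived_in_carrier[OF subset_refl] by (rule rev_finite_subset)
  \<comment> \<open>Positivity allows cancelling |G'| from |G'| |G : G'| = |G| \<le> |G'|
    |C(x)|.\<close>
  then have "card (derived G (carrier G)) > 0"
    using subgroup.one_closed[OF derived_is_subgroup[OF subset_refl]] by (auto simp: card_gt_0_iff)
  moreover have "card (derived G (carrier G)) * ab_index G
      \<le> card (derived G (carrier G)) * card (centralizer G {x})"
    using ab_index_lagrange[OF fin] order_le_card_derived_mult_card_centralizer[OF assms]
    by (simp add: mult.commute)
  ultimately show ?thesis
    by simp
qed

end

text \<open>An abelian \<open>H\<close> is proper because \<open>G\<close> is not abelian, so
  ab-maximality applies, and |H : H'| is just |H|.\<close>

lemma ab_maximal_card_abelian_less:
  assumes "ab_maximal G" and "\<not> comm_group G" and H: "subgroup H G"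
    and comm: "\<And>a b. \<lbrakk>a \<in> H; b \<in> H\<rbrakk> \<Longrightarrow> a \<otimes>\<^bsub>G\<^esub> b = b \<otimes>\<^bsub>G\<^esub> a"
  shows "card H < ab_index G"
proof -
  interpret group G
    using assms(1) by (simp add: ab_maximal_def)
  have "H \<noteq> carrier G"
    using comm assms(2) group_comm_groupI by blast
  then have "ab_index (G\<lparr>carrier := H\<rparr>) < ab_index G"
    using assms(1) H by (simp add: ab_maximal_def)
  moreover have "ab_index (G\<lparr>carrier := H\<rparr>) = card H"
    using assms(1) H comm by (intro ab_index_abelian_subgroup) (auto simp: ab_maximal_def)
  ultimately show ?thesis
    by simp
qed

text \<open>Both divisors are powers of \<open>p\<close>, so a strict inequality raises the exponent
  by at least one. Each strict step in the final chain thus yields a factor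
  \<open>p\<close>.\<close>

lemma prime_power_dvd_less:
  fixes p :: nat
  assumes "Factorial_Ring.prime p" "m dvd p ^ k" "n dvd p ^ k" "m < n"
  shows "m * p \<le> n"
proof -
  obtain i j where ij: "m = p ^ i" "n = p ^ j"
    using assms(1-3) divides_primepow_nat by metis
  have "p > 1"
    using assms(1) prime_gt_1_nat by blast
  then have "Suc i \<le> j"
    using assms(4) ij by (simp add: Suc_le_eq)
  then have "p ^ Suc i \<le> p ^ j"
    using \<open>p > 1\<close> by (intro power_increasing) auto
  then show ?thesis
    using ij by (simp add: mult.commute)
qed

theorem lemma2p2:
  fixes G :: "('a, 'b) monoid_scheme" and p :: nat
  assumes "Factorial_Ring.prime p"
    and "finite_p_group p G"
    and "\<not> comm_group G"
    and "ab_maximal G"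
  shows "ab_index G \<ge> card (center G) * p ^ 3"
proof -
  interpret group G
    using assms(2) by (simp add: finite_p_group_def)
  obtain n where fin: "finite (carrier G)" and n: "order G = p ^ n"
    using assms(2) by (auto simp: finite_p_group_def)
  have Z: "subgroup (center G) G"
    unfolding center_eq_centralizer by (rule subgroup_centralizer) simp
  obtain x where x: "x \<in> carrier G" "x \<notin> center G"
    using assms(3) group_comm_groupI by (fastforce simp: center_def)
  define B where "B = generate G (insert x (center G))"
  have subB: "insert x (center G) \<subseteq> carrier G"
    using x subgroup.subset[OF Z] by blast
  have B: "subgroup B G"
    unfolding B_def by (rule generate_is_subgroup[OF subB])
  have genB: "insert x (center G) \<subseteq> B"
    unfolding B_def by (auto intro: generate.incl)
  have commB: "a \<otimes>\<^bsub>G\<^esub> b = b \<otimes>\<^bsub>G\<^esub> a" if "a \<in> B" "b \<in> B" for a b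
    using that unfolding B_def
    by (rule generate_commute[OF subB, rotated 1]) (use x in \<open>auto simp: center_def\<close>)
  have "B \<subseteq> centralizer G {x}"
    using commB genB subgroup.subset[OF B] by (auto simp: centralizer_def)
  \<comment> \<open>Since \<open>B\<close> is abelian, |B| < |G : G'| \<le> |C(x)|. The inclusion is
    therefore strict, which supplies \<open>y\<close>.\<close>
  moreover have "card B < card (centralizer G {x})"
    using ab_maximal_card_abelian_less[OF assms(4,3) B commB]
      ab_index_le_card_centralizer[OF fin x(1)] by linarith
  ultimately obtain y where y: "y \<in> centralizer G {x}" "y \<notin> B"
    by (metis less_irrefl subsetI subset_antisym)
  define A where "A = generate G (insert y (insert x (center G)))"
  have subA: "insert y (insert x (center G)) \<subseteq> carrier G"
    using subB y by (auto simp: centralizer_def)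
  have A: "subgroup A G"
    unfolding A_def by (rule generate_is_subgroup[OF subA])
  have genA: "insert y (insert x (center G)) \<subseteq> A"
    unfolding A_def by (auto intro: generate.incl)
  \<comment> \<open>The generators commute pairwise: \<open>y\<close> was chosen in C(x), and the
    others involve a central element.\<close>
  have commA: "a \<otimes>\<^bsub>G\<^esub> b = b \<otimes>\<^bsub>G\<^esub> a" if "a \<in> A" "b \<in> A" for a b
    using that unfolding A_def
    by (rule generate_commute[OF subA, rotated 1])
      (use x y in \<open>auto simp: center_def centralizer_def\<close>)
  have "B \<subseteq> A"
    unfolding A_def B_def by (rule mono_generate) blast
  then have "B \<subset> A"
    using genA y by blast
  then have BA: "card B < card A"
    using fin subgroup.subset[OF A] by (metis finite_subset psubset_card_mono)
  have "center G \<subset> B"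
    using genB x by blast
  then have ZB: "card (center G) < card B"
    using fin subgroup.subset[OF B] by (metis finite_subset psubset_card_mono)
  have AG: "card A < ab_index G"
    by (rule ab_maximal_card_abelian_less[OF assms(4,3) A commA])
  have dvd: "card H dvd p ^ n" if "subgroup H G" for H
    using lagrange_finite[OF fin that] n by (metis dvd_triv_right)
  have "ab_index G dvd p ^ n"
    using ab_index_lagrange[OF fin] n by (metis dvd_triv_left)
  \<comment> \<open>The chain |Z(G)| < |B| < |A| < |G : G'| consists of powers of \<open>p\<close>;
    its three strict steps give the factor \<open>p ^ 3\<close>.\<close>
  then have "card A * p \<le> ab_index G"
    using prime_power_dvd_less[OF assms(1)] dvd A AG by blast
  moreover have "card B * p \<le> card A" "card (center G) * p \<le> card B"
    using prime_power_dvd_less[OF assms(1)] dvd A B Z BA ZB by blast+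
  ultimately have "card (center G) * p * p * p \<le> ab_index G"
    by (meson le_trans mult_le_mono1)
  then show ?thesis
    by (simp add: power3_eq_cube mult.assoc)
qed

end
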